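(* Let $X,Y,Z$ be real random variables such that $(X,Y)$ has copula $C(u,v)$ and joint distribution function $H$. Assume that $X,Y,Z$ have cumulative distribution functions $F_1,F_2,F_3$ respectively, that $Z$ has a density $f_3$, and that $Z$ is independent of $(X,Y)$. Then the copula of $(X+Z,Y+Z)$ is $$C_6(u,v)=\int_0^1 C\bigl(F_1(F_4^{-1}(u)-F_3^{-1}(t)),\,F_2(F_5^{-1}(v)-F_3^{-1}(t))\bigr)\,dt,$$ where $F_4(x)=\int_{-\infty}^{\infty}F_1(x-t)f_3(t)\,dt$ and $F_5(x)=\int_{-\infty}^{\infty}F_2(x-t)f_3(t)\,dt$ are the cumulative distribution functions of $X+Z$ and $Y+Z$ respectively.
   Context: A 2-copula is a function $C:[0,1]^2\to[0,1]$ with $C(0,x)=C(x,0)=0$, $C(1,x)=C(x,1)=x$ for all $x$ and $C(x_1,y_1)+C(x_2,y_2)-C(x_1,y_2)-C(x_2,y_1)\ge 0$ for all $[x_1,x_2]\times[y_1,y_2]\subset[0,1]^2$. A random pair $(V,W)$ with joint distribution function $H$ and marginal distribution functions $F,G$ has copula $C$ if $C$ is a 2-copula with $C(F(x),G(y))=H(x,y)$ for all real $x,y$; it is unique ("the" copula) when the marginals are continuous. For a continuous distribution function $F$, $F^{-1}(t)=\inf\{x: F(x)=t\}$, with $F^{-1}(0)=-\infty$, $\inf\emptyset=+\infty$, and $F(-\infty)=0$, $F(+\infty)=1$ for every distribution function $F$. *)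

theory Defs
  imports "HOL-Probability.Probability"
begin

text \<open>
  Copulas are total functions of which only the values on the unit square are meaningful;
  accordingly uniqueness of a copula means agreement on the unit square.
\<close>

definition is_copula :: "(real \<Rightarrow> real \<Rightarrow> real) \<Rightarrow> bool" where
  "is_copula C \<longleftrightarrow>
     (\<forall>x\<in>{0..1}. \<forall>y\<in>{0..1}. C x y \<in> {0..1}) \<and>
     (\<forall>x\<in>{0..1}. C 0 x = 0 \<and> C x 0 = 0 \<and> C 1 x = x \<and> C x 1 = x) \<and>
     (\<forall>x1\<in>{0..1}. \<forall>x2\<in>{0..1}. \<forall>y1\<in>{0..1}. \<forall>y2\<in>{0..1}. x1 \<le> x2 \<longrightarrow> y1 \<le> y2 \<longrightarrow>
        C x1 y1 + C x2 y2 - C x1 y2 - C x2 y1 \<ge> 0)"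

definition rv_cdf :: "'a measure \<Rightarrow> ('a \<Rightarrow> real) \<Rightarrow> real \<Rightarrow> real" where
  "rv_cdf M V = cdf (distr M borel V)"

definition joint_cdf :: "'a measure \<Rightarrow> ('a \<Rightarrow> real) \<Rightarrow> ('a \<Rightarrow> real) \<Rightarrow> real \<Rightarrow> real \<Rightarrow> real" where
  "joint_cdf M V W x y = measure M {\<omega>\<in>space M. V \<omega> \<le> x \<and> W \<omega> \<le> y}"

definition has_copula ::
  "'a measure \<Rightarrow> ('a \<Rightarrow> real) \<Rightarrow> ('a \<Rightarrow> real) \<Rightarrow> (real \<Rightarrow> real \<Rightarrow> real) \<Rightarrow> bool" where
  "has_copula M V W C \<longleftrightarrow>
     is_copula C \<and> (\<forall>x y. C (rv_cdf M V x) (rv_cdf M W y) = joint_cdf M V W x y)"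

definition is_the_copula ::
  "'a measure \<Rightarrow> ('a \<Rightarrow> real) \<Rightarrow> ('a \<Rightarrow> real) \<Rightarrow> (real \<Rightarrow> real \<Rightarrow> real) \<Rightarrow> bool" where
  "is_the_copula M V W C \<longleftrightarrow>
     has_copula M V W C \<and>
     (\<forall>C'. has_copula M V W C' \<longrightarrow> (\<forall>u\<in>{0..1}. \<forall>v\<in>{0..1}. C' u v = C u v))"

text \<open>
  The library's \<open>prob_space.indep_var\<close> forces both random variables to have the same type. This is
  the same notion for random variables of possibly different types.
\<close>

definition indep_rvs ::
  "'a measure \<Rightarrow> 'b measure \<Rightarrow> ('a \<Rightarrow> 'b) \<Rightarrow> 'c measure \<Rightarrow> ('a \<Rightarrow> 'c) \<Rightarrow> bool" where
  "indep_rvs M S V T W \<longleftrightarrow>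
     V \<in> measurable M S \<and> W \<in> measurable M T \<and>
     prob_space.indep_set M
       (sigma_sets (space M) {V -` A \<inter> space M | A. A \<in> sets S})
       (sigma_sets (space M) {W -` A \<inter> space M | A. A \<in> sets T})"

text \<open>
  The inverse takes values in the extended reals; the infimum of the empty set is
  \<^term>\<open>\<infinity> :: ereal\<close> there.
\<close>

definition cdf_inv :: "(real \<Rightarrow> real) \<Rightarrow> real \<Rightarrow> ereal" where
  "cdf_inv F t = (if t = 0 then -\<infinity> else Inf (ereal ` {x. F x = t}))"

text \<open>
  Arguments of the form \<open>cdf_inv F u - cdf_inv G t\<close> with \<open>G\<close> a continuous distribution function
  run into the library's conventional value of \<open>\<infinity> - \<infinity>\<close> at most at \<open>t = 0\<close> and \<open>t = 1\<close>, since
  \<open>cdf_inv G t\<close> is finite for \<open>0 < t < 1\<close>; an integral over \<open>t\<close> does not see these two points.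
\<close>

definition ext_cdf :: "(real \<Rightarrow> real) \<Rightarrow> ereal \<Rightarrow> real" where
  "ext_cdf F x = (if x = \<infinity> then 1 else if x = -\<infinity> then 0 else F (real_of_ereal x))"

end

theory Submission imports Defs begin

text \<open>
  For extended reals \<open>a\<close>, \<open>b\<close>, conditioning on \<open>Z\<close> writes \<open>P(X + Z \<le> a, Y + Z \<le> b)\<close> as the integral of
  \<open>C (F1 (a - z)) (F2 (b - z))\<close> over the law of \<open>Z\<close>. Since \<open>cdf_inv F3\<close> is the quantile function of
  \<open>Z\<close>, this law is the image of the uniform law on the unit interval, so \<open>C6 u v\<close> is the probability
  that \<open>X + Z \<le> cdf_inv F4 u\<close> and \<open>Y + Z \<le> cdf_inv F5 v\<close>. As \<open>F4\<close> and \<open>F5\<close> are continuous, these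
  events have probabilities \<open>u\<close> and \<open>v\<close> and increase with \<open>u\<close> and \<open>v\<close>, which gives the copula
  properties. Any other copula takes the same value there.
\<close>

section \<open>Distribution functions and copulas at extended real arguments\<close>

lemma (in prob_space) rv_cdf_eq:
  assumes [measurable]: "random_variable borel V"
  shows "rv_cdf M V x = prob {\<omega>\<in>space M. V \<omega> \<le> x}"
  unfolding rv_cdf_def cdf_def
  by (subst measure_distr) (auto intro!: arg_cong[where f=prob])

text \<open>The values 0 and 1 at the infinite points are the probabilities of the impossible and
  the sure event, so possibly infinite quantiles can serve as thresholds.\<close>

lemma (in prob_space) ext_cdf_rv_cdf:
  assumes [measurable]: "random_variable borel V"
  shows "ext_cdf (rv_cdf M V) a = prob {\<omega>\<in>space M. ereal (V \<omega>) \<le> a}"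
  by (cases a) (auto simp: ext_cdf_def rv_cdf_eq prob_space)

lemma (in prob_space) rv_cdf_in_unit:
  assumes [measurable]: "random_variable borel V"
  shows "rv_cdf M V x \<in> {0..1}"
  by (simp add: rv_cdf_eq)

text \<open>With an infinite argument one of the two events is impossible or sure, and the boundary
  values of a copula give what remains: 0 or the other marginal.\<close>

lemma (in prob_space) has_copula_ext_cdf:
  assumes [measurable]: "random_variable borel V" "random_variable borel W"
    and "has_copula M V W C"
  shows "C (ext_cdf (rv_cdf M V) a) (ext_cdf (rv_cdf M W) b) =
    prob {\<omega>\<in>space M. ereal (V \<omega>) \<le> a \<and> ereal (W \<omega>) \<le> b}"
proof -
  have C: "C (rv_cdf M V x) (rv_cdf M W y) = joint_cdf M V W x y" for x y
    using assms by (simp add: has_copula_def)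
  have bd: "C 0 x = 0" "C x 0 = 0" "C 1 x = x" "C x 1 = x" if "x \<in> {0..1}" for x
    using assms that by (auto simp: has_copula_def is_copula_def)
  note unit = rv_cdf_in_unit[OF assms(1)] rv_cdf_in_unit[OF assms(2)]
  show ?thesis
  proof (cases "\<exists>x y. a = ereal x \<and> b = ereal y")
    case True
    then show ?thesis by (auto simp: ext_cdf_def C joint_cdf_def)
  next
    case False
    then show ?thesis
      by (cases a; cases b)
         (auto simp: ext_cdf_def bd unit rv_cdf_eq prob_space)
  qed
qed

lemma (in prob_space) isCont_rv_cdf:
  assumes [measurable]: "random_variable borel V"
  shows "isCont (rv_cdf M V) x \<longleftrightarrow> prob {\<omega>\<in>space M. V \<omega> = x} = 0"
proof -
  interpret D: real_distribution "distr M borel V" by simp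
  have "measure (distr M borel V) {x} = prob {\<omega>\<in>space M. V \<omega> = x}"
    by (subst measure_distr) (auto intro!: arg_cong[where f=prob])
  then show ?thesis by (simp add: rv_cdf_def D.isCont_cdf)
qed

section \<open>Quantiles of a continuous distribution\<close>

context cdf_distribution
begin

text \<open>Here \<open>C\<close> is the distribution function and \<open>I u\<close> the least
  \<open>x\<close> with \<open>u \<le> C x\<close>. So \<open>C\<close> stays below \<open>u\<close>
  to the left of \<open>I u\<close>, and continuity carries this bound over to \<open>I u\<close>
  itself.\<close>

lemma cdf_I:
  assumes u: "0 < u" "u < 1" and cont: "\<And>x. isCont C x"
  shows "C (I u) = u"
proof (rule antisym)
  show "u \<le> C (I u)"
    by (rule pseudoinverse[OF u, THEN iffD2, OF order_refl])
  have below: "C x \<le> u" if "x < I u" for x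
    by (rule ccontr) (use pseudoinverse[OF u, THEN iffD1, of x] that in linarith)
  have "(C \<longlongrightarrow> C (I u)) (at_left (I u))"
    using cont[of "I u"] by (simp only: continuous_at_split) (simp only: continuous_within)
  moreover have "\<forall>\<^sub>F x in at_left (I u). C x \<le> u"
    using below by (simp only: eventually_at_filter) (rule always_eventually, blast)
  ultimately show "C (I u) \<le> u"
    by (rule tendsto_upperbound) (rule trivial_limit_at_left_real)
qed

text \<open>\<open>I u\<close> is the infimum of \<open>{x. u \<le> C x}\<close>, whereas
  \<open>cdf_inv\<close> uses the level set \<open>{x. C x = u}\<close>. The level set is the
  smaller of the two, but by continuity it contains \<open>I u\<close>, so the infima agree.\<close>

lemma cdf_inv_eq_I:
  assumes u: "0 < u" "u < 1" and cont: "\<And>x. isCont C x"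
  shows "cdf_inv C u = ereal (I u)"
proof -
  have "ereal (I u) \<le> ereal x" if "C x = u" for x
    unfolding ereal_less_eq by (rule pseudoinverse[OF u, THEN iffD1]) (simp only: that order_refl)
  then have "Inf (ereal ` {x. C x = u}) = ereal (I u)"
    using cdf_I[OF assms] by (intro Inf_eqI) blast+
  with u show ?thesis by (simp only: cdf_inv_def) simp
qed

text \<open>For \<open>u\<close> in the open interval this is \<open>cdf_I\<close>, and at 0 both
  conventions match. At 1 the level set is either empty, with infinite \<open>cdf_inv\<close>, or
  closed and bounded below, so that it has a least element.\<close>

lemma ext_cdf_cdf_inv:
  assumes u: "u \<in> {0..1}" and cont: "\<And>x. isCont C x"
  shows "ext_cdf C (cdf_inv C u) = u"
proof -
  consider "u = 0" | "0 < u" "u < 1" | "u = 1" using u by force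
  then show ?thesis
  proof cases
    case 2
    then show ?thesis by (simp add: cdf_inv_eq_I ext_cdf_def cdf_I cont)
  next
    case 3
    define S where "S = {x. C x = 1}"
    show ?thesis
    proof (cases "S = {}")
      case True
      with 3 show ?thesis by (simp add: cdf_inv_def ext_cdf_def S_def top_ereal_def)
    next
      case False
      \<comment> \<open>Such an \<open>l\<close> exists since \<open>C\<close> tends to 0 at minus
        infinity; by monotonicity it bounds \<open>S\<close> from below.\<close>
      obtain l where "C l < 1"
        using eventually_happens'[OF trivial_limit_at_bot_linorder order_tendstoD(2)[OF bot zero_less_one]]
        by blast
      have bdd: "bdd_below S"
      proof (rule bdd_belowI)
        fix x assume "x \<in> S"
        show "l \<le> x"
        proof (rule ccontr)
          assume "\<not> l \<le> x"
          then have "C x \<le> C l" by (intro cdf_nondecreasing) simp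
          with \<open>C l < 1\<close> \<open>x \<in> S\<close> show False by (simp add: S_def)
        qed
      qed
      have "closed S"
        unfolding S_def using cont by (intro closed_Collect_eq) (auto simp: continuous_at_imp_continuous_on)
      then have "Inf S \<in> S"
        using False bdd by (intro closed_contains_Inf)
      moreover have "Inf (ereal ` S) = ereal (Inf S)"
        using \<open>Inf S \<in> S\<close> bdd by (intro Inf_eqI) (auto intro: cInf_lower)
      ultimately show ?thesis
        using 3 by (simp add: cdf_inv_def ext_cdf_def S_def)
    qed
  qed (simp add: cdf_inv_def ext_cdf_def)
qed

text \<open>Substitution \<open>z = cdf_inv C t\<close>: the map \<open>I\<close> transports the
  uniform law on the open unit interval to \<open>M\<close>. The function \<open>h\<close> is
  prescribed only there because quantiles at the endpoints can be infinite.\<close>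

lemma integral_cdf_inv:
  fixes g h :: "real \<Rightarrow> real"
  assumes cont: "\<And>x. isCont C x" and g: "integrable M g"
    and h: "\<And>t. 0 < t \<Longrightarrow> t < 1 \<Longrightarrow> h t = g (real_of_ereal (cdf_inv C t))"
  shows "set_integrable lborel {0..1} h" "(LINT t:{0..1}|lborel. h t) = (LINT z|M. g z)"
proof -
  let ?U = "restrict_space lborel {0<..<1::real}"
  have [measurable]: "g \<in> borel_measurable borel"
    using g by (simp add: borel_measurable_integrable measurable_cong_sets[OF events_eq_borel refl, symmetric])
  have I[measurable]: "I \<in> measurable ?U borel"
    using measurable_CI by (simp add: measurable_cong_sets sets_restrict_space)
  have eq: "h t = g (I t)" if "t \<in> space ?U" for t
    using that h cdf_inv_eq_I[OF _ _ cont] by (simp add: space_restrict_space)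
  have "integrable (distr ?U borel I) g"
    using g by (simp add: distr_I_eq_M)
  then have "integrable ?U h"
    by (subst Bochner_Integration.integrable_cong[OF refl eq]) (auto simp: integrable_distr_eq)
  then have *: "set_integrable lborel {0<..<1} h"
    by (simp add: integrable_restrict_space set_integrable_def)
  have "(LINT z|M. g z) = (LINT z|distr ?U borel I. g z)"
    by (simp add: distr_I_eq_M)
  also have "\<dots> = (LINT t|?U. h t)"
    by (subst integral_distr) (auto intro!: Bochner_Integration.integral_cong simp: eq)
  also have "\<dots> = (LINT t:{0<..<1}|lborel. h t)"
    by (simp add: integral_restrict_space set_lebesgue_integral_def)
  finally have **: "(LINT z|M. g z) = (LINT t:{0<..<1}|lborel. h t)" .
  \<comment> \<open>The arbitrary endpoint values of \<open>h\<close> become multiples of indicators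
    of single points, which are integrable with integral 0.\<close>
  have split: "indicator {0..1} t *\<^sub>R h t =
      indicator {0<..<1} t *\<^sub>R h t + (indicator {0} t * h 0 + indicator {1} t * h 1)" for t :: real
    by (auto simp: indicator_def)
  have pts: "integrable lborel (\<lambda>t. indicator {0::real} t * h 0 + indicator {1} t * h 1)"
    by (intro Bochner_Integration.integrable_add integrable_mult_left integrable_real_indicator) auto
  show "set_integrable lborel {0..1} h"
    using * pts unfolding set_integrable_def split by (rule Bochner_Integration.integrable_add)
  have "(LINT t|lborel. indicator {0::real} t * h 0 + indicator {1} t * h 1) = 0"
    by (subst Bochner_Integration.integral_add) auto
  then show "(LINT t:{0..1}|lborel. h t) = (LINT z|M. g z)"
    using * pts unfolding ** set_integrable_def set_lebesgue_integral_def split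
    by (subst Bochner_Integration.integral_add) auto
qed

end

section \<open>Independence and conditioning\<close>

lemma (in prob_space) distr_indep_rvs:
  assumes "indep_rvs M S V T W"
  shows "distr M S V \<Otimes>\<^sub>M distr M T W = distr M (S \<Otimes>\<^sub>M T) (\<lambda>\<omega>. (V \<omega>, W \<omega>))"
proof -
  have [measurable]: "V \<in> measurable M S" "W \<in> measurable M T"
    and ind: "indep_set (sigma_sets (space M) {V -` A \<inter> space M | A. A \<in> sets S})
       (sigma_sets (space M) {W -` A \<inter> space M | A. A \<in> sets T})"
    using assms by (auto simp: indep_rvs_def)
  interpret V: prob_space "distr M S V" by (rule prob_space_distr) simp
  interpret W: prob_space "distr M T W" by (rule prob_space_distr) simp
  show ?thesis
  \<comment> \<open>Rectangles determine a product of sigma-finite measures, and on a rectangle the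
    claim is the product rule of independence.\<close>
  proof (rule pair_measure_eqI)
    fix A B assume "A \<in> sets (distr M S V)" "B \<in> sets (distr M T W)"
    then have [measurable]: "A \<in> sets S" "B \<in> sets T" by auto
    have "prob ((V -` A \<inter> space M) \<inter> (W -` B \<inter> space M)) =
        prob (V -` A \<inter> space M) * prob (W -` B \<inter> space M)"
      by (intro indep_setD[OF ind] sigma_sets.Basic) auto
    also have "(V -` A \<inter> space M) \<inter> (W -` B \<inter> space M) = (\<lambda>\<omega>. (V \<omega>, W \<omega>)) -` (A \<times> B) \<inter> space M"
      by auto
    finally show "emeasure (distr M S V) A * emeasure (distr M T W) B =
        emeasure (distr M (S \<Otimes>\<^sub>M T) (\<lambda>\<omega>. (V \<omega>, W \<omega>))) (A \<times> B)"
      by (simp add: emeasure_distr emeasure_eq_measure ennreal_mult)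
  qed (auto intro: V.sigma_finite_measure_axioms W.sigma_finite_measure_axioms)
qed

text \<open>Fubini for the law of \<open>(V, W)\<close>: \<open>V\<close> is frozen at
  \<open>v\<close>, then integrated out. The section probabilities are measurable and bounded by 1,
  hence integrable.\<close>

lemma (in prob_space) prob_indep_rvs:
  assumes ind: "indep_rvs M S V T W" and B[measurable]: "B \<in> sets (S \<Otimes>\<^sub>M T)"
  shows "integrable (distr M S V) (\<lambda>v. prob {\<omega>\<in>space M. (v, W \<omega>) \<in> B})"
    and "prob {\<omega>\<in>space M. (V \<omega>, W \<omega>) \<in> B} =
      (LINT v|distr M S V. prob {\<omega>\<in>space M. (v, W \<omega>) \<in> B})"
proof -
  have [measurable]: "V \<in> measurable M S" "W \<in> measurable M T"
    using ind by (auto simp: indep_rvs_def)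
  interpret V: prob_space "distr M S V" by (rule prob_space_distr) simp
  interpret W: prob_space "distr M T W" by (rule prob_space_distr) simp
  have sec: "emeasure (distr M T W) (Pair v -` B) = prob {\<omega>\<in>space M. (v, W \<omega>) \<in> B}"
    if "v \<in> space S" for v
    using that sets_Pair1[OF B, of v]
    by (auto simp: emeasure_distr emeasure_eq_measure intro!: arg_cong[where f=prob])
  have "(\<lambda>v. emeasure (distr M T W) (Pair v -` B)) \<in> borel_measurable (distr M S V)"
    by (intro W.measurable_emeasure_Pair) simp
  then have [measurable]: "(\<lambda>v. prob {\<omega>\<in>space M. (v, W \<omega>) \<in> B}) \<in> borel_measurable S"
    by (subst measurable_cong[where g="\<lambda>v. enn2real (emeasure (distr M T W) (Pair v -` B))"])
       (auto simp: sec)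
  show int: "integrable (distr M S V) (\<lambda>v. prob {\<omega>\<in>space M. (v, W \<omega>) \<in> B})"
    by (intro V.integrable_const_bound[where B=1]) auto
  have "ennreal (prob {\<omega>\<in>space M. (V \<omega>, W \<omega>) \<in> B}) =
      emeasure (distr M (S \<Otimes>\<^sub>M T) (\<lambda>\<omega>. (V \<omega>, W \<omega>))) B"
    by (auto simp: emeasure_distr emeasure_eq_measure intro!: arg_cong[where f=prob])
  also have "\<dots> = (\<integral>\<^sup>+v. emeasure (distr M T W) (Pair v -` B) \<partial>distr M S V)"
    unfolding distr_indep_rvs[OF ind, symmetric]
    by (rule W.emeasure_pair_measure_alt) simp
  also have "\<dots> = (\<integral>\<^sup>+v. prob {\<omega>\<in>space M. (v, W \<omega>) \<in> B} \<partial>distr M S V)"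
    by (intro nn_integral_cong) (simp add: sec)
  also have "\<dots> = ennreal (LINT v|distr M S V. prob {\<omega>\<in>space M. (v, W \<omega>) \<in> B})"
    by (rule nn_integral_eq_integral[OF int]) simp
  finally show "prob {\<omega>\<in>space M. (V \<omega>, W \<omega>) \<in> B} =
      (LINT v|distr M S V. prob {\<omega>\<in>space M. (v, W \<omega>) \<in> B})"
    by (simp add: integral_nonneg_AE)
qed

lemma (in prob_space) indep_rvs_commute:
  assumes "indep_rvs M S V T W"
  shows "indep_rvs M T W S V"
proof -
  have "indep_set B A" if "indep_set A B" for A B
    unfolding indep_sets2_eq
  proof (intro conjI ballI)
    fix b a assume "b \<in> B" "a \<in> A"
    then show "prob (b \<inter> a) = prob b * prob a"
      using indep_setD[OF that, of a b] by (simp add: Int_commute mult.commute)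
  qed (use that in \<open>simp_all add: indep_sets2_eq\<close>)
  then show ?thesis
    using assms unfolding indep_rvs_def by blast
qed

text \<open>A function of \<open>W\<close> generates a smaller sigma-algebra, so the product rule is
  inherited. Applied to the projections, this makes \<open>Z\<close> independent of \<open>X\<close>
  and of \<open>Y\<close> separately.\<close>

lemma (in prob_space) indep_rvs_compose:
  assumes "indep_rvs M S V T W" and [measurable]: "g \<in> measurable T R"
  shows "indep_rvs M S V R (\<lambda>\<omega>. g (W \<omega>))"
proof -
  have [measurable]: "V \<in> measurable M S" "W \<in> measurable M T"
    using assms by (auto simp: indep_rvs_def)
  have "{(\<lambda>\<omega>. g (W \<omega>)) -` A \<inter> space M |A. A \<in> sets R} \<subseteq> {W -` A \<inter> space M |A. A \<in> sets T}"
  proof safe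
    fix A assume "A \<in> sets R"
    then have "g -` A \<inter> space T \<in> sets T" by simp
    moreover have "(\<lambda>\<omega>. g (W \<omega>)) -` A \<inter> space M = W -` (g -` A \<inter> space T) \<inter> space M"
      using measurable_space[of W M T] by auto
    ultimately show "\<exists>A'. (\<lambda>\<omega>. g (W \<omega>)) -` A \<inter> space M = W -` A' \<inter> space M \<and> A' \<in> sets T"
      by blast
  qed
  then have "sigma_sets (space M) {(\<lambda>\<omega>. g (W \<omega>)) -` A \<inter> space M |A. A \<in> sets R} \<subseteq>
      sigma_sets (space M) {W -` A \<inter> space M |A. A \<in> sets T}"
    by (rule sigma_sets_mono')
  moreover have "(\<lambda>\<omega>. g (W \<omega>)) \<in> measurable M R" by measurable
  ultimately show ?thesis
    using assms(1) unfolding indep_rvs_def indep_sets2_eq by blast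
qed

lemma (in prob_space) rv_cdf_add_indep:
  assumes ind: "indep_rvs M borel Z borel X"
  shows "rv_cdf M (\<lambda>\<omega>. X \<omega> + Z \<omega>) x = (LINT z|distr M borel Z. rv_cdf M X (x - z))"
proof -
  have [measurable]: "random_variable borel X" "random_variable borel Z"
    using ind by (auto simp: indep_rvs_def)
  have "{p \<in> space (borel \<Otimes>\<^sub>M borel). snd p + fst p \<le> x} \<in> sets (borel \<Otimes>\<^sub>M borel)"
    by measurable
  from prob_indep_rvs(2)[OF ind this] show ?thesis
    by (simp add: rv_cdf_eq le_diff_eq space_pair_measure)
qed

text \<open>Conditioning on \<open>X\<close> instead of \<open>Z\<close> reduces an atom of the sum
  at \<open>x\<close> to atoms of \<open>Z\<close> at the points \<open>x - s\<close>, and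
  continuity of the law of \<open>Z\<close> excludes these.\<close>

lemma (in prob_space) isCont_rv_cdf_add_indep:
  assumes ind: "indep_rvs M borel Z borel X" and cont: "\<And>x. isCont (rv_cdf M Z) x"
  shows "isCont (rv_cdf M (\<lambda>\<omega>. X \<omega> + Z \<omega>)) x"
proof -
  have [measurable]: "random_variable borel X" "random_variable borel Z"
    using ind by (auto simp: indep_rvs_def)
  have "{p \<in> space (borel \<Otimes>\<^sub>M borel). fst p + snd p = x} \<in> sets (borel \<Otimes>\<^sub>M borel)"
    by measurable
  from prob_indep_rvs(2)[OF indep_rvs_commute[OF ind] this]
  have "prob {\<omega>\<in>space M. X \<omega> + Z \<omega> = x} =
      (LINT s|distr M borel X. prob {\<omega>\<in>space M. Z \<omega> = x - s})"
    by (simp add: eq_diff_eq add.commute space_pair_measure)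
  also have "\<dots> = 0"
    using cont by (simp add: isCont_rv_cdf)
  finally show ?thesis
    by (simp add: isCont_rv_cdf)
qed

section \<open>Copulas from quantile events\<close>

lemma (in prob_space) prob_Int_cong_subset:
  assumes [measurable]: "S \<in> events" "T \<in> events" "E \<in> events"
    and "S \<subseteq> T" "prob S = prob T"
  shows "prob (S \<inter> E) = prob (T \<inter> E)"
proof -
  have "prob (T - S) = 0"
    using assms by (simp add: finite_measure_Diff)
  moreover have "prob (T \<inter> E - S \<inter> E) \<le> prob (T - S)"
    by (intro finite_measure_mono) auto
  ultimately have "prob (T \<inter> E - S \<inter> E) = 0"
    by (simp add: measure_le_0_iff)
  then show ?thesis
    using assms by (subst (asm) finite_measure_Diff) auto
qed

text \<open>By continuity the quantile events of each variable form a chain in which the event with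
  index \<open>u\<close> has probability \<open>u\<close>. The copula properties then become facts
  about intersections of two chains, where nested events of equal probability are
  interchangeable.\<close>

lemma (in prob_space) is_the_copulaI:
  assumes [measurable]: "random_variable borel V" "random_variable borel W"
    and contV: "\<And>x. isCont (rv_cdf M V) x" and contW: "\<And>x. isCont (rv_cdf M W) x"
    and C: "\<And>u v. u \<in> {0..1} \<Longrightarrow> v \<in> {0..1} \<Longrightarrow> C u v =
      prob {\<omega>\<in>space M. ereal (V \<omega>) \<le> cdf_inv (rv_cdf M V) u \<and> ereal (W \<omega>) \<le> cdf_inv (rv_cdf M W) v}"
  shows "is_the_copula M V W C"
proof -
  define A where "A U u = {\<omega>\<in>space M. ereal (U \<omega>) \<le> cdf_inv (rv_cdf M U) u}" for U u
  have C_eq: "C u v = prob (A V u \<inter> A W v)" if "u \<in> {0..1}" "v \<in> {0..1}" for u v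
  proof -
    have "A V u \<inter> A W v = {\<omega>\<in>space M. ereal (V \<omega>) \<le> cdf_inv (rv_cdf M V) u \<and>
        ereal (W \<omega>) \<le> cdf_inv (rv_cdf M W) v}"
      by (auto simp: A_def)
    with that show ?thesis by (simp only: C)
  qed
  have A[measurable]: "A V u \<in> events" "A W u \<in> events" for u
    by (auto simp: A_def)
  have ext: "ext_cdf (rv_cdf M U) (cdf_inv (rv_cdf M U) u) = u"
    if [measurable]: "random_variable borel U" and "\<And>x. isCont (rv_cdf M U) x" "u \<in> {0..1}" for U u
  proof -
    interpret U: cdf_distribution "distr M borel U"
      by (simp add: cdf_distribution_def)
    show ?thesis using that(2,3) unfolding rv_cdf_def by (rule U.ext_cdf_cdf_inv[rotated])
  qed
  have prob_A: "prob (A V u) = u" "prob (A W u) = u" if "u \<in> {0..1}" for u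
    using ext[of V u] ext[of W u] that contV contW by (auto simp: A_def ext_cdf_rv_cdf)
  have lin: "A U u1 \<subseteq> A U u2 \<or> A U u2 \<subseteq> A U u1" for U u1 u2
    using linear[of "cdf_inv (rv_cdf M U) u1" "cdf_inv (rv_cdf M U) u2"]
    by (auto simp: A_def intro: order_trans)
  \<comment> \<open>If the inclusion went the other way, the probabilities would force
    \<open>u1 = u2\<close>, so the chain is ordered by its index.\<close>
  have mono: "prob (A U u2) = u2 \<Longrightarrow> prob (A U u1) = u1 \<Longrightarrow> A U u1 \<in> events \<Longrightarrow> A U u2 \<in> events \<Longrightarrow>
     u1 \<le> u2 \<Longrightarrow> A U u1 \<subseteq> A U u2" for U u1 u2
    using lin[of U u1 u2] finite_measure_mono[of "A U u2" "A U u1"] by force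
  have boundary: "C 0 x = 0" "C x 0 = 0" "C 1 x = x" "C x 1 = x" if "x \<in> {0..1}" for x
  proof -
    \<comment> \<open>An event with index 0 has probability 0 and can be exchanged with the empty
      set; below, an event with index 1 is exchanged with \<open>space M\<close>.\<close>
    show "C 0 x = 0" "C x 0 = 0"
      using prob_Int_cong_subset[of "{}" "A V 0" "A W x"] prob_Int_cong_subset[of "{}" "A W 0" "A V x"] that
      by (auto simp: C_eq prob_A Int_commute)
    have "A V 1 \<subseteq> space M" "A W 1 \<subseteq> space M" by (auto simp: A_def)
    moreover have "space M \<inter> A V x = A V x" "space M \<inter> A W x = A W x" by (auto simp: A_def)
    ultimately show "C 1 x = x" "C x 1 = x"
      using prob_Int_cong_subset[of "A V 1" "space M" "A W x"] that
        prob_Int_cong_subset[of "A W 1" "space M" "A V x"]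
      by (auto simp: C_eq prob_A prob_space Int_commute)
  qed
  have increasing: "C x1 y1 + C x2 y2 - C x1 y2 - C x2 y1 \<ge> 0"
    if unit: "x1 \<in> {0..1}" "x2 \<in> {0..1}" "y1 \<in> {0..1}" "y2 \<in> {0..1}" and "x1 \<le> x2" "y1 \<le> y2"
    for x1 x2 y1 y2
  proof -
    have V: "A V x1 \<subseteq> A V x2"
      by (intro mono prob_A A unit \<open>x1 \<le> x2\<close>)
    have W: "A W y1 \<subseteq> A W y2"
      by (intro mono prob_A A unit \<open>y1 \<le> y2\<close>)
    \<comment> \<open>The volume of the rectangle is the increment from \<open>y1\<close> to
      \<open>y2\<close> of the probability of the strip between \<open>A V x1\<close> and
      \<open>A V x2\<close>.\<close>
    have "prob (A V x2 \<inter> A W y - A V x1 \<inter> A W y) = prob (A V x2 \<inter> A W y) - prob (A V x1 \<inter> A W y)" for y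
      using V by (intro finite_measure_Diff) auto
    moreover have "prob (A V x2 \<inter> A W y1 - A V x1 \<inter> A W y1) \<le> prob (A V x2 \<inter> A W y2 - A V x1 \<inter> A W y2)"
      using W by (intro finite_measure_mono) auto
    ultimately show ?thesis
      using unit by (simp add: C_eq)
  qed
  \<comment> \<open>The point \<open>x\<close> lies in its own level set, so its quantile is at most
    \<open>x\<close>. The inclusion may be strict where the distribution function is flat, but both
    events have the same probability.\<close>
  have le: "A U (rv_cdf M U x) \<subseteq> {\<omega>\<in>space M. U \<omega> \<le> x}" for U x
  proof -
    have "cdf_inv (rv_cdf M U) (rv_cdf M U x) \<le> ereal x"
      by (auto simp: cdf_inv_def intro: Inf_lower)
    from order_trans[OF _ this] show ?thesis
      unfolding A_def by (intro Collect_mono) (use ereal_less_eq(3) in blast)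
  qed
  have "C (rv_cdf M V x) (rv_cdf M W y) = joint_cdf M V W x y" for x y
  proof -
    note unit = rv_cdf_in_unit[OF assms(1), of x] rv_cdf_in_unit[OF assms(2), of y]
    have eqV: "prob (A V (rv_cdf M V x)) = prob {\<omega>\<in>space M. V \<omega> \<le> x}"
      unfolding prob_A(1)[OF unit(1)] by (rule rv_cdf_eq) fact
    have eqW: "prob (A W (rv_cdf M W y)) = prob {\<omega>\<in>space M. W \<omega> \<le> y}"
      unfolding prob_A(2)[OF unit(2)] by (rule rv_cdf_eq) fact
    have "C (rv_cdf M V x) (rv_cdf M W y) = prob (A V (rv_cdf M V x) \<inter> A W (rv_cdf M W y))"
      by (intro C_eq unit)
    also have "\<dots> = prob ({\<omega>\<in>space M. V \<omega> \<le> x} \<inter> A W (rv_cdf M W y))"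
      by (rule prob_Int_cong_subset[OF A(1) _ A(2) le eqV]) simp
    also have "\<dots> = prob (A W (rv_cdf M W y) \<inter> {\<omega>\<in>space M. V \<omega> \<le> x})"
      by (simp only: Int_commute)
    also have "\<dots> = prob ({\<omega>\<in>space M. W \<omega> \<le> y} \<inter> {\<omega>\<in>space M. V \<omega> \<le> x})"
      by (rule prob_Int_cong_subset[OF A(2) _ _ le eqW]) simp_all
    also have "\<dots> = joint_cdf M V W x y"
      unfolding joint_cdf_def by (intro arg_cong[where f=prob]) auto
    finally show ?thesis .
  qed
  moreover have "C x y \<in> {0..1}" if "x \<in> {0..1}" "y \<in> {0..1}" for x y
    unfolding C_eq[OF that] by simp
  ultimately have "has_copula M V W C"
    unfolding has_copula_def is_copula_def
    by (intro conjI ballI allI impI boundary increasing)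
  \<comment> \<open>Uniqueness: \<open>u\<close> and \<open>v\<close> are values of the extended
    distribution functions at their quantiles, where any copula must equal the joint
    probability.\<close>
  moreover have "C' u v = C u v" if "has_copula M V W C'" "u \<in> {0..1}" "v \<in> {0..1}" for C' u v
    using has_copula_ext_cdf[OF assms(1,2) that(1), of "cdf_inv (rv_cdf M V) u" "cdf_inv (rv_cdf M W) v"]
      ext[OF assms(1) contV that(2)] ext[OF assms(2) contW that(3)] that(2,3) by (simp only: C)
  ultimately show ?thesis
    unfolding is_the_copula_def by blast
qed

section \<open>The copula of the sums\<close>

theorem proposition1p2p5:
  fixes M :: "'a measure"
    and X Y Z :: "'a \<Rightarrow> real"
    and C C6 :: "real \<Rightarrow> real \<Rightarrow> real"
    and F1 F2 F3 F4 F5 f3 :: "real \<Rightarrow> real"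
  assumes "prob_space M"
    and "X \<in> borel_measurable M" and "Y \<in> borel_measurable M" and "Z \<in> borel_measurable M"
    and "has_copula M X Y C"
    and "F1 = rv_cdf M X" and "F2 = rv_cdf M Y" and "F3 = rv_cdf M Z"
    and "\<And>t. 0 \<le> f3 t" and "distributed M lborel Z (\<lambda>t. ennreal (f3 t))"
    and "indep_rvs M borel Z (borel \<Otimes>\<^sub>M borel) (\<lambda>\<omega>. (X \<omega>, Y \<omega>))"
    and "F4 = (\<lambda>x. LINT t|lborel. F1 (x - t) * f3 t)"
    and "F5 = (\<lambda>x. LINT t|lborel. F2 (x - t) * f3 t)"
    and "C6 = (\<lambda>u v. LINT t:{0..1}|lborel.
              C (ext_cdf F1 (cdf_inv F4 u - cdf_inv F3 t)) (ext_cdf F2 (cdf_inv F5 v - cdf_inv F3 t)))"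
  shows "F4 = rv_cdf M (\<lambda>\<omega>. X \<omega> + Z \<omega>)
       \<and> F5 = rv_cdf M (\<lambda>\<omega>. Y \<omega> + Z \<omega>)
       \<and> (\<forall>u\<in>{0..1}. \<forall>v\<in>{0..1}.
            set_integrable lborel {0..1} (\<lambda>t.
              C (ext_cdf F1 (cdf_inv F4 u - cdf_inv F3 t)) (ext_cdf F2 (cdf_inv F5 v - cdf_inv F3 t))))
       \<and> is_the_copula M (\<lambda>\<omega>. X \<omega> + Z \<omega>) (\<lambda>\<omega>. Y \<omega> + Z \<omega>) C6"
proof -
  interpret prob_space M by fact
  note [measurable] = assms(2-4)
  note F = assms(6-8) and ind = assms(11) and C6 = assms(14)
  interpret Z: cdf_distribution "distr M borel Z"
    by (simp add: cdf_distribution_def)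
  have indX: "indep_rvs M borel Z borel X"
    using indep_rvs_compose[OF ind, of fst borel] by simp
  have indY: "indep_rvs M borel Z borel Y"
    using indep_rvs_compose[OF ind, of snd borel] by simp

  have f3[measurable]: "f3 \<in> borel_measurable borel"
    using distributed_real_measurable[OF assms(9,10)] by simp
  have Z_density: "distr M borel Z = density lborel (\<lambda>t. ennreal (f3 t))"
    using distributed_distr_eq_density[OF assms(10)] by (simp cong: distr_cong)
  \<comment> \<open>Points are Lebesgue null, so a law with a density has no atoms.\<close>
  have "measure (distr M borel Z) {x} = 0" for x
  proof -
    have "AE t in lborel. ennreal (f3 t) * indicator {x} t = 0"
      using AE_lborel_singleton[of x] by eventually_elim (simp add: indicator_def)
    then have "emeasure (density lborel (\<lambda>t. ennreal (f3 t))) {x} = 0"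
      by (subst emeasure_density) (simp_all add: nn_integral_0_iff_AE)
    then show ?thesis
      by (simp add: Z_density measure_def)
  qed
  then have contZ: "isCont F3 x" for x
    by (simp add: F rv_cdf_def Z.isCont_cdf)
  have sum_cdf: "(\<lambda>x. LINT t|lborel. rv_cdf M U (x - t) * f3 t) = rv_cdf M (\<lambda>\<omega>. U \<omega> + Z \<omega>)"
    if ind: "indep_rvs M borel Z borel U" for U
  proof
    fix x
    have [measurable]: "random_variable borel U"
      using ind by (simp add: indep_rvs_def)
    interpret U: cdf_distribution "distr M borel U"
      by (simp add: cdf_distribution_def)
    have [measurable]: "rv_cdf M U \<in> borel_measurable borel"
      by (simp add: rv_cdf_def)
    show "(LINT t|lborel. rv_cdf M U (x - t) * f3 t) = rv_cdf M (\<lambda>\<omega>. U \<omega> + Z \<omega>) x"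
      unfolding rv_cdf_add_indep[OF ind] Z_density
      by (subst integral_density) (auto simp: assms(9) mult.commute)
  qed
  have F4: "F4 = rv_cdf M (\<lambda>\<omega>. X \<omega> + Z \<omega>)" and F5: "F5 = rv_cdf M (\<lambda>\<omega>. Y \<omega> + Z \<omega>)"
    using assms(12,13) sum_cdf[OF indX] sum_cdf[OF indY] by (simp_all add: F)

  \<comment> \<open>Conditional probability of the joint event given \<open>Z = z\<close>;
    \<open>a\<close> and \<open>b\<close> are extended because the quantiles of the sums may be
    infinite.\<close>
  define G where "G a b z = prob {\<omega>\<in>space M. ereal (X \<omega> + z) \<le> a \<and> ereal (Y \<omega> + z) \<le> b}" for a b z
  have fubini: "integrable (distr M borel Z) (G a b)"
    "prob {\<omega>\<in>space M. ereal (X \<omega> + Z \<omega>) \<le> a \<and> ereal (Y \<omega> + Z \<omega>) \<le> b} = (LINT z|distr M borel Z. G a b z)"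
    for a b
  proof -
    have B: "{q \<in> space (borel \<Otimes>\<^sub>M (borel \<Otimes>\<^sub>M borel)).
        ereal (fst (snd q) + fst q) \<le> a \<and> ereal (snd (snd q) + fst q) \<le> b} \<in> sets (borel \<Otimes>\<^sub>M (borel \<Otimes>\<^sub>M borel))"
      by measurable
    show "integrable (distr M borel Z) (G a b)"
      "prob {\<omega>\<in>space M. ereal (X \<omega> + Z \<omega>) \<le> a \<and> ereal (Y \<omega> + Z \<omega>) \<le> b} = (LINT z|distr M borel Z. G a b z)"
      using prob_indep_rvs[OF ind B] by (simp_all add: G_def[abs_def] space_pair_measure)
  qed
  \<comment> \<open>Since \<open>z\<close> is real, \<open>a - ereal z\<close> never has the form
    infinity minus infinity, and \<open>z\<close> can be moved across the inequality.\<close>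
  have G_eq: "G a b z = C (ext_cdf F1 (a - ereal z)) (ext_cdf F2 (b - ereal z))" for a b z
  proof -
    have "ereal x \<le> c - ereal z \<longleftrightarrow> ereal (x + z) \<le> c" for x c
      by (cases c) auto
    then show ?thesis
      unfolding F has_copula_ext_cdf[OF assms(2,3,5)] G_def by simp
  qed
  \<comment> \<open>For \<open>t\<close> strictly between 0 and 1 the quantile of \<open>Z\<close>
    is finite, so \<open>G_eq\<close> applies with that quantile as \<open>z\<close>.\<close>
  have integrand: "C (ext_cdf F1 (a - cdf_inv F3 t)) (ext_cdf F2 (b - cdf_inv F3 t)) =
      G a b (real_of_ereal (cdf_inv (cdf (distr M borel Z)) t))" if "0 < t" "t < 1" for a b t
    using that Z.cdf_inv_eq_I[of t] contZ unfolding F rv_cdf_def by (simp add: G_eq F rv_cdf_def)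
  have int: "set_integrable lborel {0..1} (\<lambda>t.
        C (ext_cdf F1 (a - cdf_inv F3 t)) (ext_cdf F2 (b - cdf_inv F3 t)))"
      "(LINT t:{0..1}|lborel. C (ext_cdf F1 (a - cdf_inv F3 t)) (ext_cdf F2 (b - cdf_inv F3 t))) =
        (LINT z|distr M borel Z. G a b z)" for a b
    by (rule Z.integral_cdf_inv[OF contZ[unfolded F rv_cdf_def] fubini(1) integrand]; assumption)+
  have "is_the_copula M (\<lambda>\<omega>. X \<omega> + Z \<omega>) (\<lambda>\<omega>. Y \<omega> + Z \<omega>) C6"
  proof (rule is_the_copulaI)
    show "C6 u v = prob {\<omega>\<in>space M. ereal (X \<omega> + Z \<omega>) \<le> cdf_inv (rv_cdf M (\<lambda>\<omega>. X \<omega> + Z \<omega>)) u \<and>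
        ereal (Y \<omega> + Z \<omega>) \<le> cdf_inv (rv_cdf M (\<lambda>\<omega>. Y \<omega> + Z \<omega>)) v}" for u v
      unfolding C6 int(2) fubini(2) F4 F5 ..
  qed (use isCont_rv_cdf_add_indep[OF indX] isCont_rv_cdf_add_indep[OF indY] contZ in \<open>simp_all add: F\<close>)
  then show ?thesis
    using F4 F5 int(1) by blast
qed

end
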